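(* Let $f$ and $g$ be the generators of one-parameter continuous semigroups $\{F_t\}_{t\ge 0}$ and $\{G_t\}_{t\ge 0}$ on the open unit disk $\Delta$, respectively, and suppose that the semigroups commute, i.e. $F_t\circ G_s=G_s\circ F_t$ for all $s,t\ge 0$. Let $f(\tau)=0$ at some point $\tau\in\overline{\Delta}$. (i) Let $\tau\in\Delta$. If $f'(\tau)=g'(\tau)$, then $f\equiv g$. (ii) Let $\tau\in\partial\Delta$. Suppose $f$ and $g$ admit the representations $$f(z)=f'(\tau)(z-\tau)+\ldots+\frac{f^{(m)}(\tau)}{m!}(z-\tau)^m+o\left(|z-\tau|^m\right)$$ and $$g(z)=g(\tau)+g'(\tau)(z-\tau)+\ldots+\frac{g^{(m)}(\tau)}{m!}(z-\tau)^m+o\left(|z-\tau|^m\right)$$ when $z\to\tau$ along some curve lying in $\Delta$ and ending at $\tau$. If $f^{(m)}(\tau)=g^{(m)}(\tau)\neq 0$, then $f\equiv g$.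
   Context: $\Delta=\{z\in\mathbb{C}:|z|<1\}$. A family $\{F_t\}_{t\ge 0}$ of holomorphic self-mappings of $\Delta$ is a one-parameter continuous semigroup on $\Delta$ if $F_t(F_s(z))=F_{t+s}(z)$ for all $t,s\ge 0$ and $\lim_{t\to 0^+}F_t(z)=z$ for all $z\in\Delta$. For such a family the limit $f(z)=\lim_{t\to 0^+}\frac{z-F_t(z)}{t}$ exists for every $z\in\Delta$ and defines a holomorphic function $f:\Delta\to\mathbb{C}$, called the generator of the semigroup; $u(t,z)=F_t(z)$ is the unique solution of $\partial u/\partial t+f(u)=0$, $u(0,z)=z$. In (ii), $m$ is a positive integer, and for $\tau\in\partial\Delta$ the symbols $f^{(k)}(\tau)$, $g^{(k)}(\tau)$ denote the complex numbers determined by the coefficients of the stated expansions.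
   Formalization: In (i), f is additionally assumed not identically zero; otherwise the claim fails: f ≡ 0 (F_t the identity), g(z) = z² − 1, τ = 0 satisfy f(τ) = 0 and f'(τ) = g'(τ) = 0 but f is not g. *)

theory Defs
  imports "HOL-Complex_Analysis.Complex_Analysis" "HOL-Library.Landau_Symbols"
begin

abbreviation unit_disk :: "complex set" where
  "unit_disk \<equiv> ball 0 1"

(* F 0 = id on the disk is not required separately: it follows from the last two clauses. *)
definition holo_semigroup :: "(real \<Rightarrow> complex \<Rightarrow> complex) \<Rightarrow> bool" where
  "holo_semigroup F \<longleftrightarrow>
     (\<forall>t\<ge>0. F t holomorphic_on unit_disk \<and> F t ` unit_disk \<subseteq> unit_disk) \<and>
     (\<forall>t\<ge>0. \<forall>s\<ge>0. \<forall>z\<in>unit_disk. F t (F s z) = F (t + s) z) \<and>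
     (\<forall>z\<in>unit_disk. ((\<lambda>t. F t z) \<longlongrightarrow> z) (at_right 0))"

(* Note the sign: the semigroup solves u' + f(u) = 0.  The values of f outside the disk are
   unconstrained, and holomorphy of f is a consequence rather than part of the definition. *)
definition is_generator :: "(complex \<Rightarrow> complex) \<Rightarrow> (real \<Rightarrow> complex \<Rightarrow> complex) \<Rightarrow> bool" where
  "is_generator f F \<longleftrightarrow>
     (\<forall>z\<in>unit_disk. ((\<lambda>t. (z - F t z) / of_real t) \<longlongrightarrow> f z) (at_right 0))"

definition semigroups_commute ::
    "(real \<Rightarrow> complex \<Rightarrow> complex) \<Rightarrow> (real \<Rightarrow> complex \<Rightarrow> complex) \<Rightarrow> bool" where
  "semigroups_commute F G \<longleftrightarrow>
     (\<forall>s\<ge>0. \<forall>t\<ge>0. \<forall>z\<in>unit_disk. F t (G s z) = G s (F t z))"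

definition curve_in_disk_to :: "(real \<Rightarrow> complex) \<Rightarrow> complex \<Rightarrow> bool" where
  "curve_in_disk_to \<gamma> \<tau> \<longleftrightarrow>
     path \<gamma> \<and> \<gamma> ` {0..<1} \<subseteq> unit_disk \<and> pathfinish \<gamma> = \<tau>"

(* a k plays the role of the k-th derivative of h at the boundary point \<tau>; in particular
   a 0 is the boundary value of h.  For \<tau> on the unit circle, a continuous \<gamma> meets \<tau> only
   at parameter 1, so z tending to \<tau> within the trace is the same as the parameter tending
   to 1 from the left. *)
definition expansion_along ::
    "(complex \<Rightarrow> complex) \<Rightarrow> complex \<Rightarrow> (real \<Rightarrow> complex) \<Rightarrow> nat \<Rightarrow> (nat \<Rightarrow> complex) \<Rightarrow> bool" where
  "expansion_along h \<tau> \<gamma> m a \<longleftrightarrow>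
     (\<lambda>z. h z - (\<Sum>k\<le>m. a k / fact k * (z - \<tau>) ^ k))
       \<in> o[at \<tau> within \<gamma> ` {0..<1}](\<lambda>z. of_real (cmod (z - \<tau>) ^ m))"

end

theory Submission
  imports Defs
begin

text \<open>
  Differentiating \<open>F t \<circ> G s = G s \<circ> F t\<close> in \<open>t\<close> and then in \<open>s\<close> gives \<open>f' * g = g' * f\<close>, so \<open>g = c * f\<close>
  for a constant \<open>c\<close> unless \<open>f\<close> vanishes identically.  Comparing one nonzero Taylor coefficient, at an
  interior point or along the curve, yields \<open>c = 1\<close>.

  Holomorphy of \<open>f\<close> and the convergence of the derivatives of the difference quotients rest on
  the Berkson-Porta idea: for a self-map \<open>F\<close> of the disk, \<open>z - F z\<close> is a field tangent to the unit
  circle plus \<open>(z - \<tau>) * (1 - cnj \<tau> * z) * P z\<close> with \<open>Re P \<ge> 0\<close>.  Harnack's inequality then makes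
  the quotients a normal family.  The same representation shows that \<open>f' \<tau> \<noteq> 0\<close> at an interior zero
  \<open>\<tau>\<close> of \<open>f\<close>: otherwise \<open>P \<tau> = 0\<close>, and \<open>P = 0\<close> by the open mapping theorem.
\<close>

section \<open>Fields tangent to the unit circle and the Berkson-Porta quotient\<close>

text \<open>The solution \<open>\<alpha>\<close> of the real-linear equation
  \<open>\<alpha> - cnj \<alpha> * \<tau>\<^sup>2 = w\<close>: substituting the conjugate equation
  eliminates \<open>cnj \<alpha>\<close> and leaves \<open>\<alpha> * (1 - cmod \<tau> ^ 4) = w +
  cnj w * \<tau>\<^sup>2\<close>.\<close>

definition tangent_coeff :: "complex \<Rightarrow> complex \<Rightarrow> complex" where
  "tangent_coeff \<tau> w = (w + cnj w * \<tau>\<^sup>2) / (1 - of_real (cmod \<tau> ^ 4))"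

lemma tangent_coeff_eq:
  assumes "cmod \<tau> < 1"
  shows "tangent_coeff \<tau> w - cnj (tangent_coeff \<tau> w) * \<tau>\<^sup>2 = w"
proof -
  have lt: "cmod \<tau> ^ 4 < 1"
    using assms by (simp add: power_less_one_iff)
  then have "complex_of_real (1 - cmod \<tau> ^ 4) \<noteq> 0"
    by (metis diff_gt_0_iff_gt less_numeral_extra(3) of_real_eq_0_iff)
  then have ne: "1 - complex_of_real (cmod \<tau> ^ 4) \<noteq> 0" by simp
  have n4: "complex_of_real (cmod \<tau> ^ 4) = \<tau>\<^sup>2 * (cnj \<tau>)\<^sup>2"
  proof -
    have "complex_of_real (cmod \<tau> ^ 4) = (complex_of_real ((cmod \<tau>)\<^sup>2))\<^sup>2"
      by (simp flip: power_mult)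
    then show ?thesis by (simp only: complex_norm_square power_mult_distrib)
  qed
  have "cnj (tangent_coeff \<tau> w) = (cnj w + w * (cnj \<tau>)\<^sup>2) / (1 - of_real (cmod \<tau> ^ 4))"
    unfolding tangent_coeff_def by simp
  then have "tangent_coeff \<tau> w - cnj (tangent_coeff \<tau> w) * \<tau>\<^sup>2
      = (w + cnj w * \<tau>\<^sup>2 - (cnj w + w * (cnj \<tau>)\<^sup>2) * \<tau>\<^sup>2) / (1 - of_real (cmod \<tau> ^ 4))"
    by (simp add: tangent_coeff_def diff_divide_distrib)
  also have "w + cnj w * \<tau>\<^sup>2 - (cnj w + w * (cnj \<tau>)\<^sup>2) * \<tau>\<^sup>2 = w * (1 - of_real (cmod \<tau> ^ 4))"
    unfolding n4 by (simp add: algebra_simps)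
  finally show ?thesis using ne by simp
qed

lemma tangent_coeff_0 [simp]: "tangent_coeff \<tau> 0 = 0"
  by (simp add: tangent_coeff_def)

lemma tangent_coeff_divide_real:
  "tangent_coeff \<tau> (w / of_real t) = tangent_coeff \<tau> w / of_real t"
  by (cases "t = 0") (simp_all add: tangent_coeff_def field_simps)

lemma tendsto_tangent_coeff [tendsto_intros]:
  assumes "(h \<longlongrightarrow> w) X"
  shows "((\<lambda>x. tangent_coeff \<tau> (h x)) \<longlongrightarrow> tangent_coeff \<tau> w) X"
\<comment> \<open>For \<open>cmod \<tau> = 1\<close> division by zero makes
  \<open>tangent_coeff \<tau>\<close> constantly 0, so the limit is trivial.\<close>
proof (cases "1 - complex_of_real (cmod \<tau> ^ 4) = 0")
  case True
  then show ?thesis by (simp add: tangent_coeff_def)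
next
  case False
  then show ?thesis unfolding tangent_coeff_def by (intro tendsto_intros assms)
qed

text \<open>
  Subtracting the field \<open>\<alpha> - cnj \<alpha> * z\<^sup>2\<close>, which is tangent to the unit circle, makes \<open>q\<close> vanish
  at \<open>\<tau>\<close> without changing \<open>Re (cnj z * q z)\<close> on the circle; there
  \<open>(z - \<tau>) * (1 - cnj \<tau> * z) = z * (cmod (z - \<tau>))\<^sup>2\<close>.
\<close>
definition disk_quot :: "complex \<Rightarrow> (complex \<Rightarrow> complex) \<Rightarrow> complex \<Rightarrow> complex" where
  "disk_quot \<tau> q z =
     (q z - tangent_coeff \<tau> (q \<tau>) + cnj (tangent_coeff \<tau> (q \<tau>)) * z\<^sup>2)
       / ((z - \<tau>) * (1 - cnj \<tau> * z))"

lemma one_minus_cnj_mult_nonzero: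
  assumes "cmod \<tau> < 1" "cmod z \<le> 1"
  shows "1 - cnj \<tau> * z \<noteq> 0"
proof
  assume "1 - cnj \<tau> * z = 0"
  then have "cmod (cnj \<tau> * z) = 1" by (metis eq_iff_diff_eq_0 norm_one)
  moreover have "cmod \<tau> * cmod z \<le> cmod \<tau> * 1" using assms by (intro mult_left_mono) auto
  ultimately show False using assms by (simp add: norm_mult)
qed

text \<open>The numerator of \<open>disk_quot\<close> vanishes at \<open>\<tau>\<close>, so the
  singularity there is removable and the value of \<open>P\<close> at \<open>\<tau>\<close> is
  governed by the derivative of the numerator. The sign of the real part passes to
  \<open>\<tau>\<close> by continuity. A general open \<open>S\<close> allows both the disk itself
  and a neighbourhood of its closure.\<close>

lemma disk_quot_extends:
  assumes \<tau>: "cmod \<tau> < 1" and q: "q holomorphic_on S" and S: "open S" "\<tau> \<in> S"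
    and nz: "\<And>z. z \<in> S \<Longrightarrow> 1 - cnj \<tau> * z \<noteq> 0"
  obtains P where "P holomorphic_on S"
    and "\<And>z. z \<noteq> \<tau> \<Longrightarrow> P z = disk_quot \<tau> q z"
    and "P \<tau> = (deriv q \<tau> + 2 * cnj (tangent_coeff \<tau> (q \<tau>)) * \<tau>) / (1 - cnj \<tau> * \<tau>)"
    and "(\<And>z. z \<in> S \<Longrightarrow> 0 \<le> Re (disk_quot \<tau> q z)) \<Longrightarrow> (\<And>z. z \<in> S \<Longrightarrow> 0 \<le> Re (P z))"
    and "\<And>z. z \<in> S \<Longrightarrow> q z = tangent_coeff \<tau> (q \<tau>) - cnj (tangent_coeff \<tau> (q \<tau>)) * z\<^sup>2
            + (z - \<tau>) * (1 - cnj \<tau> * z) * P z"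
proof -
  define \<alpha> where "\<alpha> = tangent_coeff \<tau> (q \<tau>)"
  define N where "N = (\<lambda>z. q z - \<alpha> + cnj \<alpha> * z\<^sup>2)"
  define Q where "Q = (\<lambda>z. if z = \<tau> then deriv N \<tau> else (N z - N \<tau>) / (z - \<tau>))"
  define P where "P = (\<lambda>z. Q z / (1 - cnj \<tau> * z))"
  have "q \<tau> = \<alpha> - cnj \<alpha> * \<tau>\<^sup>2"
    unfolding \<alpha>_def by (rule tangent_coeff_eq[OF \<tau>, symmetric])
  then have N0: "N \<tau> = 0" by (simp add: N_def)
  have "N holomorphic_on S" unfolding N_def by (intro holomorphic_intros q)
  then have "Q holomorphic_on S" unfolding Q_def by (rule pole_lemma_open[OF _ S(1)])
  then have 1: "P holomorphic_on S" unfolding P_def by (intro holomorphic_intros nz)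
  have 2: "P z = disk_quot \<tau> q z" if "z \<noteq> \<tau>" for z
    unfolding P_def Q_def N0 disk_quot_def using that
    by (simp add: N_def \<alpha>_def mult.commute)
  have "(q has_field_derivative deriv q \<tau>) (at \<tau>)"
    using q S holomorphic_derivI by blast
  then have "(N has_field_derivative deriv q \<tau> + 2 * cnj \<alpha> * \<tau>) (at \<tau>)"
    unfolding N_def by (auto intro!: derivative_eq_intros)
  then have 3: "P \<tau> = (deriv q \<tau> + 2 * cnj \<alpha> * \<tau>) / (1 - cnj \<tau> * \<tau>)"
    by (simp add: P_def Q_def DERIV_imp_deriv)
  have 4: "q z = \<alpha> - cnj \<alpha> * z\<^sup>2 + (z - \<tau>) * (1 - cnj \<tau> * z) * P z" if "z \<in> S" for z
  proof (cases "z = \<tau>")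
    case True
    then show ?thesis using \<open>q \<tau> = _\<close> by simp
  next
    case False
    then have "(z - \<tau>) * (1 - cnj \<tau> * z) * P z = N z"
      using nz[OF that] by (simp add: P_def Q_def N0)
    then show ?thesis by (simp add: N_def)
  qed
  have 5: "0 \<le> Re (P z)" if nn: "\<And>z. z \<in> S \<Longrightarrow> 0 \<le> Re (disk_quot \<tau> q z)" and z: "z \<in> S" for z
  proof (cases "z = \<tau>")
    case True
    have "isCont P \<tau>"
      using holomorphic_on_imp_continuous_on[OF 1] continuous_on_eq_continuous_at[OF S(1)] S(2)
      by blast
    then have lim: "((\<lambda>w. Re (P w)) \<longlongrightarrow> Re (P \<tau>)) (at \<tau>)"
      by (intro tendsto_Re) (simp add: isCont_def)
    have "eventually (\<lambda>w. w \<in> S) (at \<tau>)"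
      using S by (rule eventually_at_in_open')
    moreover have "eventually (\<lambda>w. w \<noteq> \<tau>) (at \<tau>)" by (rule eventually_neq_at_within)
    ultimately have "eventually (\<lambda>w. 0 \<le> Re (P w)) (at \<tau>)"
      by eventually_elim (simp add: 2 nn)
    with lim show ?thesis unfolding True by (rule tendsto_lowerbound) simp
  qed (simp add: 2 nn z)
  show thesis using 1 2 3 5 4 unfolding \<alpha>_def by (rule that)
qed

section \<open>Nonnegative real part of the quotient for self-maps of the disk\<close>

text \<open>Multiply numerator and denominator by \<open>cnj z\<close>. On the circle the
  denominator becomes \<open>(cmod (1 - cnj \<tau> * z))\<^sup>2\<close>, and the numerator becomes
  \<open>1 - cnj z * F z\<close> minus the difference of a number and its conjugate, which is purely
  imaginary.\<close>

lemma Re_disk_quot_circle: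
  assumes \<tau>: "cmod \<tau> < 1" and z: "cmod z = 1" and F: "cmod (F z) \<le> 1"
  shows "0 \<le> Re (disk_quot \<tau> (\<lambda>z. z - F z) z)"
proof -
  define \<alpha> where "\<alpha> = tangent_coeff \<tau> (\<tau> - F \<tau>)"
  have zz: "cnj z * z = 1" using z complex_norm_square[of z] by (simp add: mult.commute)
  define M where "M = cnj z * (z - F z - \<alpha> + cnj \<alpha> * z\<^sup>2)"
  have "M = 1 - cnj z * F z - (cnj z * \<alpha> - cnj (cnj z * \<alpha>))"
    using zz by (simp add: M_def algebra_simps power2_eq_square)
  then have "Re M = 1 - Re (cnj z * F z)" by simp
  moreover have "Re (cnj z * F z) \<le> cmod (cnj z * F z)" by (rule complex_Re_le_cmod)
  ultimately have M: "0 \<le> Re M" using F z by (simp add: norm_mult)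
  have D: "cnj z * ((z - \<tau>) * (1 - cnj \<tau> * z)) = of_real ((cmod (1 - cnj \<tau> * z))\<^sup>2)"
    using zz unfolding complex_norm_square by (simp add: algebra_simps)
  have "disk_quot \<tau> (\<lambda>z. z - F z) z = M / (cnj z * ((z - \<tau>) * (1 - cnj \<tau> * z)))"
    using zz by (auto simp: disk_quot_def M_def \<alpha>_def)
  then show ?thesis unfolding D by (simp add: M divide_nonneg_nonneg)
qed

text \<open>Since \<open>F\<close> is holomorphic beyond the closed disk, the maximum principle for
  \<open>Re (- P z)\<close> carries the sign from the circle to the interior.\<close>

lemma Re_disk_quot_closed:
  assumes \<tau>: "cmod \<tau> < 1" and R: "1 < R" and F: "F holomorphic_on ball 0 R"
    and le: "\<And>z. cmod z = 1 \<Longrightarrow> cmod (F z) \<le> 1" and z: "cmod z < 1"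
  shows "0 \<le> Re (disk_quot \<tau> (\<lambda>z. z - F z) z)"
proof (cases "z = \<tau>")
  case True
  \<comment> \<open>Division by zero gives \<open>disk_quot\<close> the value 0 at its base
    point.\<close>
  then show ?thesis by (simp add: disk_quot_def)
next
  case False
  \<comment> \<open>The zero of \<open>1 - cnj \<tau> * z\<close> lies outside the closed disk but
    possibly inside \<open>ball 0 R\<close>, so it is cut out.\<close>
  define S where "S = ball (0::complex) R \<inter> {z. 1 - cnj \<tau> * z \<noteq> 0}"
  have "open {z. 1 - cnj \<tau> * z \<noteq> 0}"
    by (intro open_Collect_neq continuous_intros)
  then have S: "open S" by (simp add: S_def open_Int)
  have cS: "cball 0 1 \<subseteq> S"
    using R one_minus_cnj_mult_nonzero[OF \<tau>] by (auto simp: S_def)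
  have hol: "(\<lambda>z. z - F z) holomorphic_on S"
    by (intro holomorphic_intros holomorphic_on_subset[OF F]) (auto simp: S_def)
  have nz: "1 - cnj \<tau> * z \<noteq> 0" if "z \<in> S" for z using that by (simp add: S_def)
  have \<tau>S: "\<tau> \<in> S" using cS \<tau> by auto
  obtain P where P: "P holomorphic_on S"
    and PD: "\<And>z. z \<noteq> \<tau> \<Longrightarrow> P z = disk_quot \<tau> (\<lambda>z. z - F z) z"
    by (rule disk_quot_extends[OF \<tau> hol S \<tau>S nz], assumption) (rule that)
  have mP: "(\<lambda>z. - P z) holomorphic_on S" by (intro holomorphic_intros P)
  have "Re (- P z) \<le> 0"
  proof (rule maximum_real_frontier[where f = "\<lambda>z. - P z" and S = "cball 0 1"])
    show "(\<lambda>z. - P z) holomorphic_on interior (cball 0 1)"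
      using cS by (intro holomorphic_on_subset[OF mP]) auto
    show "continuous_on (closure (cball 0 1)) (\<lambda>z. - P z)"
      using cS holomorphic_on_imp_continuous_on[OF mP] by (simp add: continuous_on_subset)
    show "Re (- P w) \<le> 0" if "w \<in> frontier (cball 0 1)" for w
    proof -
      have "cmod w = 1" using that by simp
      moreover from this have "w \<noteq> \<tau>" using \<tau> by auto
      ultimately show ?thesis using Re_disk_quot_circle[OF \<tau>, of w F] le PD by simp
    qed
  qed (use z in auto)
  then show ?thesis using PD[OF False] by simp
qed

text \<open>The dilation \<open>F (of_real r * z)\<close> with \<open>0 < r < 1\<close> is
  holomorphic on the disk of radius \<open>1 / r > 1\<close>, so the previous case applies to it.
  The inequality survives the limit as \<open>r\<close> tends to 1 from the left.\<close>

lemma Re_disk_quot_nonneg: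
  assumes \<tau>: "cmod \<tau> < 1" and F: "F holomorphic_on ball 0 1" "F ` ball 0 1 \<subseteq> ball 0 1"
    and z: "cmod z < 1"
  shows "0 \<le> Re (disk_quot \<tau> (\<lambda>z. z - F z) z)"
proof (cases "z = \<tau>")
  case True
  then show ?thesis by (simp add: disk_quot_def)
next
  case False
  have lim: "((\<lambda>r. F (of_real r * w)) \<longlongrightarrow> F w) (at_left (1::real))" if "cmod w < 1" for w
  proof -
    have "w \<in> ball 0 1" using that by simp
    then have "isCont F w"
      using holomorphic_on_imp_continuous_on[OF F(1)] continuous_on_eq_continuous_at[OF open_ball]
      by blast
    moreover have "((\<lambda>r. of_real r * w) \<longlongrightarrow> of_real 1 * w) (at_left (1::real))"
      by (intro tendsto_intros)
    ultimately show ?thesis using isCont_tendsto_compose[of w F] by simp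
  qed
  have nz: "(z - \<tau>) * (1 - cnj \<tau> * z) \<noteq> 0"
    using False one_minus_cnj_mult_nonzero[OF \<tau>, of z] z by simp
  have "((\<lambda>r. disk_quot \<tau> (\<lambda>z. z - F (of_real r * z)) z) \<longlongrightarrow> disk_quot \<tau> (\<lambda>z. z - F z) z)
          (at_left (1::real))"
    unfolding disk_quot_def by (intro tendsto_intros lim z \<tau> nz)
  then have "((\<lambda>r. Re (disk_quot \<tau> (\<lambda>z. z - F (of_real r * z)) z))
       \<longlongrightarrow> Re (disk_quot \<tau> (\<lambda>z. z - F z) z)) (at_left (1::real))"
    by (rule tendsto_Re)
  moreover have "eventually (\<lambda>r. 0 < r \<and> r < 1) (at_left (1::real))"
    using eventually_at_left_real[of 0 "1::real"] by simp
  then have "eventually (\<lambda>r. 0 \<le> Re (disk_quot \<tau> (\<lambda>z. z - F (of_real r * z)) z)) (at_left (1::real))"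
  proof eventually_elim
    case (elim r)
    have im: "(\<lambda>w. of_real r * w) ` ball 0 (1 / r) \<subseteq> (ball 0 1 :: complex set)"
      using elim by (auto simp: norm_mult field_simps)
    have "(F \<circ> (\<lambda>w. of_real r * w)) holomorphic_on ball 0 (1 / r)"
      by (intro holomorphic_on_compose_gen[OF _ F(1) im] holomorphic_intros)
    moreover have "cmod (F (of_real r * w)) \<le> 1" if "cmod w = 1" for w
    proof -
      have "of_real r * w \<in> ball 0 1" using elim that by (simp add: norm_mult)
      then show ?thesis using F(2) by (force simp: image_subset_iff)
    qed
    ultimately show ?case
      using elim z by (intro Re_disk_quot_closed[OF \<tau>, of "1 / r"]) (simp_all add: o_def)
  qed
  ultimately show ?thesis by (rule tendsto_lowerbound) simp
qed

lemma disk_quot_divide_real: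
  "disk_quot \<tau> (\<lambda>z. q z / of_real t) z = disk_quot \<tau> q z / of_real t"
proof -
  have "q z / of_real t - \<alpha> / of_real t + cnj (\<alpha> / of_real t) * z\<^sup>2
      = (q z - \<alpha> + cnj \<alpha> * z\<^sup>2) / of_real t" for \<alpha>
    by (simp add: diff_divide_distrib add_divide_distrib)
  then show ?thesis
    unfolding disk_quot_def tangent_coeff_divide_real by (simp add: mult.commute)
qed

section \<open>Normality of the difference quotients and holomorphy of generators\<close>

text \<open>Adding 1 makes the real part strictly positive, so the Cayley-type map
  \<open>\<phi>\<close> is defined, sends the disk into itself and fixes 0. The Schwarz lemma for
  \<open>\<phi>\<close> then bounds \<open>cmod (k z)\<close> by
  \<open>(1 + r) / (1 - r) * cmod (k 0)\<close>.\<close>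

lemma Harnack_nonneg_Re:
  assumes h: "h holomorphic_on ball 0 1" and Re: "\<And>z. cmod z < 1 \<Longrightarrow> 0 \<le> Re (h z)"
    and z: "cmod z \<le> r" "r < 1"
  shows "cmod (h z) \<le> 1 + 2 * (1 + cmod (h 0)) / (1 - r)"
proof -
  define k where "k = (\<lambda>z. h z + 1)"
  have k: "0 < Re (k z)" if "cmod z < 1" for z using Re[OF that] by (simp add: k_def)
  have nz: "k w + cnj (k 0) \<noteq> 0" if "cmod w < 1" for w
  proof
    assume "k w + cnj (k 0) = 0"
    then have "Re (k w + cnj (k 0)) = 0" by simp
    then show False using k[OF that] k[of 0] by simp
  qed
  define \<phi> where "\<phi> = (\<lambda>z. (k z - k 0) / (k z + cnj (k 0)))"
  have "cmod (\<phi> z) \<le> cmod z"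
  proof (rule Schwarz_Lemma)
    show "\<phi> holomorphic_on ball 0 1"
      unfolding \<phi>_def k_def using nz
      by (intro holomorphic_intros h) (auto simp: k_def)
    show "cmod (\<phi> w) < 1" if "cmod w < 1" for w
    proof -
      \<comment> \<open>The point \<open>- cnj (k 0)\<close> is the reflection of \<open>k 0\<close>
        in the imaginary axis, so any point of the right half-plane is closer to
        \<open>k 0\<close>.\<close>
      have "(cmod (k w - k 0))\<^sup>2 = (cmod (k w + cnj (k 0)))\<^sup>2 - 4 * Re (k w) * Re (k 0)"
        unfolding cmod_power2 by (simp add: power2_eq_square algebra_simps)
      moreover have "0 < Re (k w) * Re (k 0)" using k[OF that] k[of 0] by (intro mult_pos_pos) auto
      ultimately have "(cmod (k w - k 0))\<^sup>2 < (cmod (k w + cnj (k 0)))\<^sup>2" by linarith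
      then have "cmod (k w - k 0) < cmod (k w + cnj (k 0))" by (simp add: power_less_imp_less_base)
      then show ?thesis using nz[OF that] by (simp add: \<phi>_def norm_divide divide_less_eq)
    qed
  qed (use z in \<open>auto simp: \<phi>_def\<close>)
  then have "cmod (k z - k 0) \<le> cmod z * cmod (k z + cnj (k 0))"
    using nz[of z] z by (simp add: \<phi>_def norm_divide divide_le_eq)
  also have "\<dots> \<le> r * (cmod (k z) + cmod (k 0))"
    using z norm_triangle_ineq[of "k z" "cnj (k 0)"] by (intro mult_mono) (auto intro: order_trans[OF norm_ge_zero])
  finally have "cmod (k z) - cmod (k 0) \<le> r * (cmod (k z) + cmod (k 0))"
    using norm_triangle_ineq2[of "k z" "k 0"] by linarith
  then have "cmod (k z) * (1 - r) \<le> (1 + r) * cmod (k 0)" by (simp add: algebra_simps)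
  also have "\<dots> \<le> 2 * (1 + cmod (h 0))"
    using z norm_triangle_ineq[of "h 0" 1] order_trans[OF norm_ge_zero z(1)]
    by (intro mult_mono) (auto simp: k_def)
  finally have "cmod (k z) \<le> 2 * (1 + cmod (h 0)) / (1 - r)" using z by (simp add: le_divide_eq)
  moreover have "cmod (h z) \<le> cmod (k z) + 1"
    using norm_triangle_ineq4[of "k z" 1] by (simp add: k_def)
  ultimately show ?thesis by linarith
qed

text \<open>\<open>disk_quot \<tau> q z\<close> depends on \<open>q\<close> only through
  \<open>q z\<close> and \<open>q \<tau>\<close>, so pointwise convergence of the difference
  quotients transfers the sign to \<open>f\<close>.\<close>

lemma generator_Re_disk_quot:
  assumes F: "holo_semigroup F" and f: "is_generator f F" and \<tau>: "cmod \<tau> < 1" and z: "cmod z < 1"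
  shows "0 \<le> Re (disk_quot \<tau> f z)"
proof (cases "z = \<tau>")
  case True
  then show ?thesis by (simp add: disk_quot_def)
next
  case False
  then have nz: "(z - \<tau>) * (1 - cnj \<tau> * z) \<noteq> 0"
    using one_minus_cnj_mult_nonzero[OF \<tau>, of z] z by simp
  have lim: "((\<lambda>t. (w - F t w) / of_real t) \<longlongrightarrow> f w) (at_right 0)" if "cmod w < 1" for w
    using f that by (simp add: is_generator_def)
  have "((\<lambda>t. disk_quot \<tau> (\<lambda>z. (z - F t z) / of_real t) z) \<longlongrightarrow> disk_quot \<tau> f z) (at_right 0)"
    unfolding disk_quot_def by (intro tendsto_intros lim z \<tau> nz)
  then have "((\<lambda>t. Re (disk_quot \<tau> (\<lambda>z. (z - F t z) / of_real t) z)) \<longlongrightarrow> Re (disk_quot \<tau> f z))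
      (at_right 0)"
    by (rule tendsto_Re)
  moreover have "eventually (\<lambda>t. 0 \<le> Re (disk_quot \<tau> (\<lambda>z. (z - F t z) / of_real t) z)) (at_right 0)"
    using eventually_at_right_less
  proof eventually_elim
    case (elim t)
    then have "0 \<le> Re (disk_quot \<tau> (\<lambda>z. z - F t z) z)"
      using F by (intro Re_disk_quot_nonneg \<tau> z) (auto simp: holo_semigroup_def)
    then show ?case unfolding disk_quot_divide_real using elim by simp
  qed
  ultimately show ?thesis by (rule tendsto_lowerbound) simp
qed

text \<open>
  A function with nonnegative real part is controlled by its value at \<open>0\<close>, and this value is
  available for the quotients based at \<open>1/2\<close>; so the difference quotients form a normal family.
\<close>
lemma generator_uniform_limit:
  assumes F: "holo_semigroup F" and f: "is_generator f F"
  obtains s :: "nat \<Rightarrow> real" where "\<And>n. 0 < s n" and "s \<longlonglongrightarrow> 0"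
    and "f holomorphic_on ball 0 1"
    and "\<And>K. compact K \<Longrightarrow> K \<subseteq> ball 0 1 \<Longrightarrow>
           uniform_limit K (\<lambda>n z. (z - F (s n) z) / of_real (s n)) f sequentially"
proof -
  define t where "t = (\<lambda>n. inverse (real (Suc n)))"
  define q where "q = (\<lambda>n z. (z - F (t n) z) / of_real (t n))"
  \<comment> \<open>With a nonzero base point, \<open>P n 0\<close> is built from values of
    \<open>q n\<close>, which converge. At the base point itself it would involve
    \<open>deriv (q n) \<tau>\<close>, about which nothing is known yet.\<close>
  define \<tau> :: complex where "\<tau> = 1 / 2"
  have \<tau>: "cmod \<tau> < 1" "\<tau> \<in> ball 0 1" by (simp_all add: \<tau>_def norm_divide)
  have t: "0 < t n" for n by (simp add: t_def)
  have t0: "t \<longlonglongrightarrow> 0" unfolding t_def by (rule LIMSEQ_inverse_real_of_nat)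
  have tr: "filterlim t (at_right 0) sequentially"
    using t0 t by (auto simp: filterlim_at less_imp_neq[symmetric])
  have lim: "(\<lambda>n. q n z) \<longlonglongrightarrow> f z" if "cmod z < 1" for z
    using f that unfolding is_generator_def q_def by (auto intro: filterlim_compose[OF _ tr])
  have holF: "F (t n) holomorphic_on ball 0 1" "F (t n) ` ball 0 1 \<subseteq> ball 0 1" for n
    using F t[of n] by (auto simp: holo_semigroup_def)
  have hol: "q n holomorphic_on ball 0 1" for n
    using t[of n] unfolding q_def by (intro holomorphic_intros holF) auto
  have Re: "0 \<le> Re (disk_quot \<tau> (q n) z)" if "z \<in> ball 0 1" for n z
  proof -
    have "0 \<le> Re (disk_quot \<tau> (\<lambda>z. z - F (t n) z) z)"
      using that by (intro Re_disk_quot_nonneg \<tau> holF) auto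
    then show ?thesis unfolding q_def disk_quot_divide_real using t[of n] by simp
  qed
  have "\<exists>P. P holomorphic_on ball 0 1 \<and> P 0 = disk_quot \<tau> (q n) 0 \<and> (\<forall>z\<in>ball 0 1. 0 \<le> Re (P z)) \<and>
      (\<forall>z\<in>ball 0 1. q n z = tangent_coeff \<tau> (q n \<tau>) - cnj (tangent_coeff \<tau> (q n \<tau>)) * z\<^sup>2
            + (z - \<tau>) * (1 - cnj \<tau> * z) * P z)" for n
  proof -
    have "(0::complex) \<noteq> \<tau>" by (simp add: \<tau>_def)
    moreover have "1 - cnj \<tau> * z \<noteq> 0" if "z \<in> ball 0 1" for z
      using one_minus_cnj_mult_nonzero[OF \<tau>(1)] that by simp
    ultimately show ?thesis
      using disk_quot_extends[OF \<tau>(1) hol open_ball \<tau>(2), of n] Re[of _ n] by metis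
  qed
  then obtain P where P: "\<And>n. P n holomorphic_on ball 0 1" "\<And>n. P n 0 = disk_quot \<tau> (q n) 0"
      "\<And>n z. z \<in> ball 0 1 \<Longrightarrow> 0 \<le> Re (P n z)"
      "\<And>n z. z \<in> ball 0 1 \<Longrightarrow> q n z = tangent_coeff \<tau> (q n \<tau>) - cnj (tangent_coeff \<tau> (q n \<tau>)) * z\<^sup>2
            + (z - \<tau>) * (1 - cnj \<tau> * z) * P n z"
    by metis
  have "(\<lambda>n. P n 0) \<longlonglongrightarrow> disk_quot \<tau> f 0"
    unfolding P(2) disk_quot_def by (intro tendsto_intros lim \<tau>) (simp_all add: \<tau>_def)
  then have "Bseq (\<lambda>n. P n 0)" by (intro convergent_imp_Bseq) (auto simp: convergent_def)
  then obtain B where B: "\<And>n. cmod (P n 0) \<le> B" by (auto simp: Bseq_def)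
  have "(\<lambda>n. tangent_coeff \<tau> (q n \<tau>)) \<longlonglongrightarrow> tangent_coeff \<tau> (f \<tau>)"
    by (intro tendsto_intros lim \<tau>)
  then have "Bseq (\<lambda>n. tangent_coeff \<tau> (q n \<tau>))"
    by (intro convergent_imp_Bseq) (auto simp: convergent_def)
  then obtain A where A: "\<And>n. cmod (tangent_coeff \<tau> (q n \<tau>)) \<le> A" by (auto simp: Bseq_def)
  have bdd: "\<exists>C. \<forall>h\<in>range q. \<forall>z\<in>K. cmod (h z) \<le> C" if K: "compact K" "K \<subseteq> ball 0 1" for K
  proof -
    obtain r where r: "r < 1" "\<And>z. z \<in> K \<Longrightarrow> cmod z \<le> r"
    proof (cases "K = {}")
      case True
      then show ?thesis using that[of 0] by simp
    next
      case False
      then obtain w where "w \<in> K" "\<And>z. z \<in> K \<Longrightarrow> cmod z \<le> cmod w"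
        using continuous_attains_sup[OF K(1) False, of cmod] by (auto intro: continuous_intros)
      then show ?thesis using K(2) that[of "cmod w"] by auto
    qed
    \<comment> \<open>The two terms with \<open>A\<close> bound the tangent field, each 2 bounds one
      of the factors \<open>z - \<tau>\<close> and \<open>1 - cnj \<tau> * z\<close>, and the last
      factor is the Harnack bound for \<open>P n\<close>.\<close>
    have "cmod (q n z) \<le> A + A * 1 + 2 * 2 * (1 + 2 * (1 + B) / (1 - r))" if z: "z \<in> K" for n z
    proof -
      have z1: "cmod z < 1" "z \<in> ball 0 1" using z r by fastforce+
      have "cmod (P n z) \<le> 1 + 2 * (1 + cmod (P n 0)) / (1 - r)"
        using P r z by (intro Harnack_nonneg_Re) auto
      also have "\<dots> \<le> 1 + 2 * (1 + B) / (1 - r)"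
        using B[of n] r by (intro add_left_mono divide_right_mono) auto
      finally have Pn: "cmod (P n z) \<le> 1 + 2 * (1 + B) / (1 - r)" .
      have "cmod (q n z) \<le> cmod (tangent_coeff \<tau> (q n \<tau>))
          + cmod (cnj (tangent_coeff \<tau> (q n \<tau>)) * z\<^sup>2) + cmod ((z - \<tau>) * (1 - cnj \<tau> * z) * P n z)"
        unfolding P(4)[OF z1(2), of n]
        by (intro norm_triangle_le add_right_mono norm_triangle_ineq4)
      also have "cmod (cnj (tangent_coeff \<tau> (q n \<tau>)) * z\<^sup>2) \<le> A * 1"
        unfolding norm_mult norm_power using z1 A[of n] order_trans[OF norm_ge_zero A[of n]]
        by (intro mult_mono) (auto simp: power_le_one)
      also have "cmod ((z - \<tau>) * (1 - cnj \<tau> * z) * P n z) \<le> 2 * 2 * (1 + 2 * (1 + B) / (1 - r))"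
      proof -
        have "cmod (z - \<tau>) \<le> 2" using norm_triangle_ineq4[of z \<tau>] z1 \<tau> by simp
        moreover have "cmod (cnj \<tau> * z) \<le> 1 * 1"
          unfolding norm_mult using z1 \<tau> by (intro mult_mono) auto
        then have "cmod (1 - cnj \<tau> * z) \<le> 2" using norm_triangle_ineq4[of 1 "cnj \<tau> * z"] by simp
        ultimately show ?thesis unfolding norm_mult using Pn by (intro mult_mono) auto
      qed
      finally show ?thesis using A[of n] by simp
    qed
    then show ?thesis by blast
  qed
  obtain g r where g: "g holomorphic_on ball 0 1" and r: "strict_mono (r :: nat \<Rightarrow> nat)"
    and gl: "\<And>z. z \<in> ball 0 1 \<Longrightarrow> (\<lambda>n. q (r n) z) \<longlonglongrightarrow> g z"
    and ul: "\<And>K. compact K \<Longrightarrow> K \<subseteq> ball 0 1 \<Longrightarrow> uniform_limit K (q \<circ> r) g sequentially"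
  proof (rule Montel[OF open_ball _ bdd order_refl])
    show "h holomorphic_on ball 0 1" if "h \<in> range q" for h
      using that hol by blast
  qed (assumption | rule that)+
  \<comment> \<open>Pointwise convergence of the whole sequence identifies the Montel limit with
    \<open>f\<close>, which makes \<open>f\<close> holomorphic.\<close>
  have gf: "g z = f z" if "z \<in> ball 0 1" for z
    using gl[OF that] LIMSEQ_subseq_LIMSEQ[OF lim r, of z] that
    by (auto simp: o_def intro: LIMSEQ_unique)
  show thesis
  proof
    show "0 < (t \<circ> r) n" for n using t by simp
    show "(t \<circ> r) \<longlonglongrightarrow> 0" using t0 r by (rule LIMSEQ_subseq_LIMSEQ)
    show "f holomorphic_on ball 0 1" using g gf by (metis holomorphic_transform)
    show "uniform_limit K (\<lambda>n z. (z - F ((t \<circ> r) n) z) / of_real ((t \<circ> r) n)) f sequentially"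
      if "compact K" "K \<subseteq> ball 0 1" for K
    proof (rule iffD1[OF uniform_limit_cong' ul[OF that]])
      show "g z = f z" if "z \<in> K" for z using gf that \<open>K \<subseteq> ball 0 1\<close> by blast
    qed (simp add: q_def)
  qed
qed

lemma generator_holomorphic:
  assumes "holo_semigroup F" and "is_generator f F"
  shows "f holomorphic_on unit_disk"
  by (rule generator_uniform_limit[OF assms])

section \<open>The bracket identity for commuting semigroups\<close>

text \<open>A chain rule in Caratheodory form, which avoids dividing by \<open>z - w x\<close>, a
  quantity that may vanish. The filter is general because it serves both for
  \<open>at_right 0\<close> and for a sequence of times.\<close>

lemma tendsto_difference_quotient_compose:
  fixes \<phi> :: "complex \<Rightarrow> complex"
  assumes "(\<phi> has_field_derivative D) (at z)" and w: "(w \<longlongrightarrow> z) X"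
    and l: "((\<lambda>x. (z - w x) / c x) \<longlongrightarrow> l) X"
  shows "((\<lambda>x. (\<phi> z - \<phi> (w x)) / c x) \<longlongrightarrow> D * l) X"
proof -
  obtain L where L: "\<And>w. \<phi> w - \<phi> z = L w * (w - z)" "isCont L z" "L z = D"
    using assms(1) by (auto simp: CARAT_DERIV)
  have "((\<lambda>x. L (w x) * ((z - w x) / c x)) \<longlongrightarrow> L z * l) X"
    by (intro tendsto_mult isCont_tendsto_compose[OF L(2)] w l)
  moreover have "L (w x) * ((z - w x) / c x) = (\<phi> z - \<phi> (w x)) / c x" for x
  proof -
    have "\<phi> z - \<phi> (w x) = - (\<phi> (w x) - \<phi> z)" by simp
    also have "\<dots> = L (w x) * (z - w x)" unfolding L(1) by (simp add: algebra_simps)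
    finally show ?thesis by simp
  qed
  ultimately show ?thesis unfolding L(3) by (simp only:)
qed

text \<open>Both sides are the derivative, up to sign, of \<open>F t (G s z) = G s (F t z)\<close>
  in \<open>t\<close> at 0.\<close>

lemma commute_generator_compose:
  assumes F: "holo_semigroup F" and G: "holo_semigroup G" and f: "is_generator f F"
    and comm: "semigroups_commute F G" and s: "0 \<le> s" and z: "z \<in> unit_disk"
  shows "f (G s z) = deriv (G s) z * f z"
proof (rule tendsto_unique)
  have Gz: "G s z \<in> unit_disk" and hol: "G s holomorphic_on unit_disk"
    using G s z by (auto simp: holo_semigroup_def image_subset_iff)
  show "((\<lambda>t. (G s z - F t (G s z)) / of_real t) \<longlongrightarrow> f (G s z)) (at_right 0)"
    using f Gz unfolding is_generator_def by blast
  have "((\<lambda>t. (G s z - G s (F t z)) / of_real t) \<longlongrightarrow> deriv (G s) z * f z) (at_right 0)"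
    using F f z unfolding holo_semigroup_def is_generator_def
    by (intro tendsto_difference_quotient_compose holomorphic_derivI[OF hol]) auto
  moreover have "eventually (\<lambda>t. (G s z - G s (F t z)) / of_real t = (G s z - F t (G s z)) / of_real t)
      (at_right 0)"
    using eventually_at_right_less
    by eventually_elim (use comm s z in \<open>auto simp: semigroups_commute_def\<close>)
  ultimately show "((\<lambda>t. (G s z - F t (G s z)) / of_real t) \<longlongrightarrow> deriv (G s) z * f z) (at_right 0)"
    by (rule Lim_transform_eventually)
qed simp

text \<open>Differentiates \<open>f (G s z) = deriv (G s) z * f z\<close> in \<open>s\<close> at 0.
  Locally uniform convergence of the difference quotients along the times \<open>s n\<close> is what
  makes \<open>(1 - deriv (G (s n)) z) / s n\<close> tend to \<open>deriv g z\<close>.\<close>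

lemma commute_generators_bracket:
  assumes F: "holo_semigroup F" and G: "holo_semigroup G"
    and f: "is_generator f F" and g: "is_generator g G"
    and comm: "semigroups_commute F G" and z: "z \<in> unit_disk"
  shows "deriv f z * g z = deriv g z * f z"
proof -
  obtain s where s: "\<And>n. 0 < s n" "s \<longlonglongrightarrow> 0"
    and "g holomorphic_on unit_disk"
    and ul: "\<And>K. compact K \<Longrightarrow> K \<subseteq> unit_disk \<Longrightarrow>
           uniform_limit K (\<lambda>n z. (z - G (s n) z) / of_real (s n)) g sequentially"
    by (rule generator_uniform_limit[OF G g]) (rule that)
  have holf: "f holomorphic_on unit_disk" by (rule generator_holomorphic[OF F f])
  have sr: "filterlim s (at_right 0) sequentially" using s by (auto simp: filterlim_at less_imp_neq[symmetric])
  have holG: "G (s n) holomorphic_on unit_disk" for n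
    using G s(1)[of n] by (simp add: holo_semigroup_def)
  obtain d where d: "0 < d" "cball z d \<subseteq> unit_disk" using z open_contains_cball open_ball by metis
  have "(\<lambda>n. deriv (\<lambda>z. (z - G (s n) z) / of_real (s n)) z) \<longlonglongrightarrow> deriv g z"
  proof (rule deriv_complex_uniform_limit)
    show "uniform_limit (ball z d) (\<lambda>n z. (z - G (s n) z) / of_real (s n)) g sequentially"
      using ul[OF compact_cball d(2)] by (rule uniform_limit_on_subset) auto
    show "eventually (\<lambda>n. (\<lambda>z. (z - G (s n) z) / of_real (s n)) holomorphic_on ball z d) sequentially"
      using s(1) d(2)
      by (intro always_eventually allI holomorphic_intros holomorphic_on_subset[OF holG])
        (auto simp: less_imp_neq[symmetric] ball_subset_cball[THEN subsetD])
  qed (use d in auto)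
  moreover have "deriv (\<lambda>z. (z - G (s n) z) / of_real (s n)) z = (1 - deriv (G (s n)) z) / of_real (s n)"
    for n
    using holomorphic_derivI[OF holG[of n] open_ball z] s(1)[of n]
    by (intro DERIV_imp_deriv) (auto intro!: derivative_eq_intros)
  ultimately have "(\<lambda>n. (1 - deriv (G (s n)) z) / of_real (s n)) \<longlonglongrightarrow> deriv g z" by simp
  then have "(\<lambda>n. (1 - deriv (G (s n)) z) / of_real (s n) * f z) \<longlonglongrightarrow> deriv g z * f z"
    by (intro tendsto_intros)
  moreover have "(\<lambda>n. (1 - deriv (G (s n)) z) / of_real (s n) * f z)
      = (\<lambda>n. (f z - f (G (s n) z)) / of_real (s n))"
  proof
    show "(1 - deriv (G (s n)) z) / of_real (s n) * f z = (f z - f (G (s n) z)) / of_real (s n)" for n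
      using commute_generator_compose[OF F G f comm less_imp_le[OF s(1)[of n]] z]
      by (simp add: algebra_simps diff_divide_distrib)
  qed
  moreover have "(\<lambda>n. (f z - f (G (s n) z)) / of_real (s n)) \<longlonglongrightarrow> deriv f z * g z"
  proof (rule tendsto_difference_quotient_compose[where \<phi> = f])
    show "(f has_field_derivative deriv f z) (at z)" using holf z by (intro holomorphic_derivI) auto
    show "(\<lambda>n. G (s n) z) \<longlonglongrightarrow> z"
      using G z by (intro filterlim_compose[OF _ sr]) (auto simp: holo_semigroup_def)
    show "(\<lambda>n. (z - G (s n) z) / of_real (s n)) \<longlonglongrightarrow> g z"
      using g z by (intro filterlim_compose[OF _ sr, of "\<lambda>s. (z - G s z) / of_real s"])
        (auto simp: is_generator_def)
  qed
  ultimately show ?thesis using LIMSEQ_unique by metis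
qed

section \<open>Constant ratio of the generators, and double zeros\<close>

text \<open>The bracket is the numerator of the derivative of \<open>g / f\<close>, so this ratio is
  constant on a ball around \<open>z0\<close> where \<open>f\<close> has no zero. The identity
  theorem extends \<open>g = c * f\<close> to \<open>S\<close>.\<close>

lemma proportional_if_bracket_zero:
  fixes f g :: "complex \<Rightarrow> complex"
  assumes f: "f holomorphic_on S" and g: "g holomorphic_on S" and S: "open S" "connected S"
    and eq: "\<And>z. z \<in> S \<Longrightarrow> deriv f z * g z = deriv g z * f z"
    and z0: "z0 \<in> S" "f z0 \<noteq> 0"
  obtains c where "\<And>z. z \<in> S \<Longrightarrow> g z = c * f z"
proof -
  have "open (S \<inter> f -` (- {0}))"
    using holomorphic_on_imp_continuous_on[OF f] S(1) by (intro continuous_open_preimage) auto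
  then obtain d where d: "0 < d" "ball z0 d \<subseteq> S \<inter> f -` (- {0})"
    using z0 by (metis IntI openE vimageI ComplI singletonD)
  have "((\<lambda>z. g z / f z) has_field_derivative 0) (at z)" if "z \<in> ball z0 d" for z
  proof -
    have z: "z \<in> S" "f z \<noteq> 0" using that d by auto
    have "((\<lambda>z. g z / f z) has_field_derivative (deriv g z * f z - g z * deriv f z) / (f z * f z)) (at z)"
      by (intro DERIV_divide holomorphic_derivI[OF f S(1)] holomorphic_derivI[OF g S(1)] z)
    then show ?thesis using eq[OF z(1)] by (simp add: mult.commute)
  qed
  then obtain c where c: "\<And>z. z \<in> ball z0 d \<Longrightarrow> g z / f z = c"
    using has_field_derivative_zero_constant[of "ball z0 d" "\<lambda>z. g z / f z"]
    by (metis convex_ball has_field_derivative_at_within)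
  have "g z = c * f z" if "z \<in> S" for z
  proof (rule analytic_continuation_open[of "ball z0 d" S g "\<lambda>z. c * f z"])
    show "g w = c * f w" if "w \<in> ball z0 d" for w
    proof -
      have "f w \<noteq> 0" using that d(2) by blast
      then show ?thesis using c[OF that] by (simp add: divide_eq_eq)
    qed
    show "(\<lambda>z. c * f z) holomorphic_on S" by (intro holomorphic_intros f)
  qed (use d S g that in auto)
  then show thesis by (rule that)
qed

text \<open>The tangent field for \<open>f \<tau> = 0\<close> is zero, so \<open>P \<tau>\<close> is
  a multiple of \<open>deriv f \<tau>\<close> and vanishes. A nonconstant \<open>P\<close> would
  cover a neighbourhood of 0 and hence take negative real values.\<close>

lemma generator_double_zero:
  assumes F: "holo_semigroup F" and f: "is_generator f F" and \<tau>: "\<tau> \<in> unit_disk"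
    and zero: "f \<tau> = 0" "deriv f \<tau> = 0" and z: "z \<in> unit_disk"
  shows "f z = 0"
proof -
  have \<tau>1: "cmod \<tau> < 1" using \<tau> by simp
  have hol: "f holomorphic_on unit_disk" by (rule generator_holomorphic[OF F f])
  have nz: "1 - cnj \<tau> * z \<noteq> 0" if "z \<in> unit_disk" for z
    using one_minus_cnj_mult_nonzero[OF \<tau>1] that by simp
  have Re: "0 \<le> Re (disk_quot \<tau> f w)" if "w \<in> unit_disk" for w
    using generator_Re_disk_quot[OF F f \<tau>1, of w] that by simp
  obtain P where P: "P holomorphic_on unit_disk" and P0: "P \<tau> = 0"
    and ReP: "\<And>w. w \<in> unit_disk \<Longrightarrow> 0 \<le> Re (P w)"
    and fP: "\<And>w. w \<in> unit_disk \<Longrightarrow> f w = (w - \<tau>) * (1 - cnj \<tau> * w) * P w"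
    using disk_quot_extends[OF \<tau>1 hol open_ball \<tau> nz] Re zero
    by (metis (no_types, lifting) add_0 complex_cnj_zero diff_zero div_0 mult_zero_left mult_zero_right tangent_coeff_0)
  have "P constant_on unit_disk"
  proof (rule ccontr)
    assume "\<not> P constant_on unit_disk"
    then have "open (P ` unit_disk)" by (intro open_mapping_thm[OF P]) auto
    moreover have "0 \<in> P ` unit_disk" using P0 \<tau> by (metis imageI)
    ultimately obtain e where e: "0 < e" "ball 0 e \<subseteq> P ` unit_disk" by (meson openE)
    have "complex_of_real (- (e / 2)) \<in> ball 0 e" using e(1) by simp
    then obtain w where "w \<in> unit_disk" "P w = complex_of_real (- (e / 2))" using e(2) by (metis imageE subsetD)
    then show False using ReP[of w] e(1) by simp
  qed
  then have "P z = P \<tau>" using z \<tau> unfolding constant_on_def by metis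
  then show ?thesis using fP[OF z] P0 by simp
qed

section \<open>Uniqueness of expansions at a boundary point\<close>

text \<open>By induction on the degree: the top term is itself small compared with the next lower
  power, so dropping it leaves an instance of degree \<open>m\<close>. Once the lower coefficients
  vanish, only a multiple of \<open>(z - \<tau>) ^ Suc m\<close> remains, and this power is not
  small compared with itself.\<close>

lemma expansion_coeffs_zero:
  fixes d :: "nat \<Rightarrow> complex"
  assumes X: "X \<noteq> bot" "X \<le> at \<tau>"
    and o: "(\<lambda>z. \<Sum>k\<le>m. d k * (z - \<tau>) ^ k) \<in> o[X](\<lambda>z. (z - \<tau>) ^ m)"
    and k: "k \<le> m"
  shows "d k = 0"
  using o k
proof (induction m arbitrary: k)
  case 0
  have "(\<lambda>z. d 0) \<in> o[X](\<lambda>_. 1 :: complex)" using 0 by simp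
  then have "((\<lambda>z. d 0) \<longlongrightarrow> 0) X" using smalloD_tendsto by fastforce
  then show ?case using 0 X(1) by (simp add: tendsto_const_iff)
next
  case (Suc m)
  have ne: "eventually (\<lambda>z. z \<noteq> \<tau>) X"
    using X(2) filter_leD eventually_neq_at_within by blast
  have lim: "((\<lambda>z. z - \<tau>) \<longlongrightarrow> \<tau> - \<tau>) X"
    using X(2) by (intro tendsto_intros) (auto intro: tendsto_mono)
  have o1: "(\<lambda>z. (z - \<tau>) ^ Suc m) \<in> o[X](\<lambda>z. (z - \<tau>) ^ m)"
  proof (rule smalloI_tendsto)
    have "((\<lambda>z. z - \<tau>) \<longlongrightarrow> 0) X" using lim by simp
    moreover have "eventually (\<lambda>z. z - \<tau> = (z - \<tau>) ^ Suc m / (z - \<tau>) ^ m) X"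
      using ne by eventually_elim simp
    ultimately show "((\<lambda>z. (z - \<tau>) ^ Suc m / (z - \<tau>) ^ m) \<longlongrightarrow> 0) X"
      by (rule Lim_transform_eventually)
    show "eventually (\<lambda>z. (z - \<tau>) ^ m \<noteq> 0) X" using ne by eventually_elim simp
  qed
  have "(\<lambda>z. (\<Sum>k\<le>Suc m. d k * (z - \<tau>) ^ k) - d (Suc m) * (z - \<tau>) ^ Suc m) \<in> o[X](\<lambda>z. (z - \<tau>) ^ m)"
    using landau_o.small_trans[OF Suc.prems(1) o1] o1 by (intro sum_in_smallo) auto
  then have z: "d j = 0" if "j \<le> m" for j using Suc.IH that by simp
  have o2: "(\<lambda>z. d (Suc m) * (z - \<tau>) ^ Suc m) \<in> o[X](\<lambda>z. (z - \<tau>) ^ Suc m)"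
    using Suc.prems(1) z by simp
  have "d (Suc m) = 0"
  proof (rule ccontr)
    assume "d (Suc m) \<noteq> 0"
    then have "(\<lambda>z. (z - \<tau>) ^ Suc m) \<in> o[X](\<lambda>z. (z - \<tau>) ^ Suc m)"
      by (rule iffD1[OF landau_o.small.cmult_in_iff o2])
    then have "eventually (\<lambda>z. (z - \<tau>) ^ Suc m = 0) X" by (simp only: landau_o.small_refl_iff)
    with ne have "eventually (\<lambda>_. False) X" by eventually_elim simp
    then show False using X(1) by (simp add: trivial_limit_def)
  qed
  then show ?case using z Suc.prems(2) le_Suc_eq by auto
qed

text \<open>On the curve \<open>c * f - g\<close> vanishes, so the two remainders combine to a
  polynomial with coefficients \<open>(b k - c * a k) / fact k\<close> that is small of order
  \<open>m\<close>.\<close>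

lemma expansion_along_scale_unique:
  assumes \<tau>: "cmod \<tau> = 1" and \<gamma>: "curve_in_disk_to \<gamma> \<tau>"
    and f: "expansion_along f \<tau> \<gamma> m a" and g: "expansion_along g \<tau> \<gamma> m b"
    and gf: "\<And>z. z \<in> unit_disk \<Longrightarrow> g z = c * f z" and k: "k \<le> m"
  shows "b k = c * a k"
proof -
  define X where "X = at \<tau> within \<gamma> ` {0..<1}"
  have sub: "\<gamma> ` {0..<1} \<subseteq> unit_disk" and path: "path \<gamma>" and \<gamma>1: "\<gamma> 1 = \<tau>"
    using \<gamma> by (auto simp: curve_in_disk_to_def pathfinish_def)
  \<comment> \<open>Without this the filter would be trivial and the expansions would carry no
    information. Before parameter 1 the curve stays in the open disk, so it approaches
    \<open>\<tau>\<close> through points different from \<open>\<tau>\<close>.\<close>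
  have "\<tau> islimpt \<gamma> ` {0..<1}"
  proof -
    have cont: "continuous (at 1 within {0..1}) \<gamma>"
      using path by (simp add: path_def continuous_on_eq_continuous_within)
    then have "(\<gamma> \<longlongrightarrow> \<tau>) (at 1 within {0..<1})"
      unfolding continuous_within \<gamma>1 by (rule tendsto_within_subset) auto
    moreover have "at (1::real) within {0..<1} \<noteq> bot"
      by (simp add: at_within_eq_bot_iff)
    moreover have "eventually (\<lambda>t. \<gamma> t \<in> \<gamma> ` {0..<1} - {\<tau>}) (at 1 within {0..<1})"
    proof -
      have "\<gamma> t \<noteq> \<tau>" if "t \<in> {0..<1}" for t
        using sub \<tau> that by (metis dist_0_norm imageI less_irrefl mem_ball subsetD)
      then show ?thesis by (auto simp: eventually_at_filter intro!: always_eventually)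
    qed
    then have "eventually (\<lambda>t. \<gamma> t \<in> closure (\<gamma> ` {0..<1} - {\<tau>})) (at 1 within {0..<1})"
      by (rule eventually_mono) (rule subsetD[OF closure_subset])
    ultimately have "\<tau> \<in> closure (\<gamma> ` {0..<1} - {\<tau>})"
      by (intro Lim_in_closed_set[OF closed_closure])
    then show ?thesis by (simp add: islimpt_in_closure)
  qed
  then have X: "X \<noteq> bot" "X \<le> at \<tau>"
    unfolding X_def by (auto simp: trivial_limit_within intro: at_le)
  have D: "(\<lambda>z. g z - (\<Sum>k\<le>m. b k / fact k * (z - \<tau>) ^ k)) \<in> o[X](\<lambda>z. (z - \<tau>) ^ m)"
    "(\<lambda>z. f z - (\<Sum>k\<le>m. a k / fact k * (z - \<tau>) ^ k)) \<in> o[X](\<lambda>z. (z - \<tau>) ^ m)"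
  proof -
    \<comment> \<open>Landau classes see only norms, so the real gauge may be replaced by the
      complex power.\<close>
    have eq: "o[X](\<lambda>z. complex_of_real (cmod (z - \<tau>) ^ m)) = o[X](\<lambda>z. (z - \<tau>) ^ m)"
      by (simp add: smallo_def norm_power)
    show "(\<lambda>z. g z - (\<Sum>k\<le>m. b k / fact k * (z - \<tau>) ^ k)) \<in> o[X](\<lambda>z. (z - \<tau>) ^ m)"
      "(\<lambda>z. f z - (\<Sum>k\<le>m. a k / fact k * (z - \<tau>) ^ k)) \<in> o[X](\<lambda>z. (z - \<tau>) ^ m)"
      using g f by (simp_all only: expansion_along_def X_def[symmetric] eq)
  qed
  have cD: "(\<lambda>z. c * (f z - (\<Sum>k\<le>m. a k / fact k * (z - \<tau>) ^ k))) \<in> o[X](\<lambda>z. (z - \<tau>) ^ m)"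
  \<comment> \<open>The scaling rule for small-o needs a nonzero constant.\<close>
  proof (cases "c = 0")
    case False
    then show ?thesis by (rule iffD2[OF landau_o.small.cmult_in_iff D(2)])
  qed (simp only: mult_zero_left zero_in_smallo)
  have small: "(\<lambda>z. c * (f z - (\<Sum>k\<le>m. a k / fact k * (z - \<tau>) ^ k))
        - (g z - (\<Sum>k\<le>m. b k / fact k * (z - \<tau>) ^ k))) \<in> o[X](\<lambda>z. (z - \<tau>) ^ m)"
    by (rule sum_in_smallo(2)[OF cD D(1)])
  have ev: "eventually (\<lambda>z. c * (f z - (\<Sum>k\<le>m. a k / fact k * (z - \<tau>) ^ k))
        - (g z - (\<Sum>k\<le>m. b k / fact k * (z - \<tau>) ^ k))
      = (\<Sum>k\<le>m. (b k - c * a k) / fact k * (z - \<tau>) ^ k)) X"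
  proof -
    have "eventually (\<lambda>z. z \<in> \<gamma> ` {0..<1}) X" unfolding X_def by (simp add: eventually_at_filter)
    then show ?thesis
    proof eventually_elim
      case (elim z)
      then have "g z = c * f z" using sub gf by blast
      then have "c * (f z - (\<Sum>k\<le>m. a k / fact k * (z - \<tau>) ^ k)) - (g z - (\<Sum>k\<le>m. b k / fact k * (z - \<tau>) ^ k))
          = (\<Sum>k\<le>m. b k / fact k * (z - \<tau>) ^ k) - (\<Sum>k\<le>m. c * (a k / fact k * (z - \<tau>) ^ k))"
        by (simp only: right_diff_distrib sum_distrib_left) simp
      also have "\<dots> = (\<Sum>k\<le>m. (b k - c * a k) / fact k * (z - \<tau>) ^ k)"
        unfolding sum_subtractf[symmetric]
        by (rule sum.cong) (simp_all add: diff_divide_distrib left_diff_distrib)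
      finally show ?case .
    qed
  qed
  have "(\<lambda>z. \<Sum>k\<le>m. (b k - c * a k) / fact k * (z - \<tau>) ^ k) \<in> o[X](\<lambda>z. (z - \<tau>) ^ m)"
    by (rule iffD1[OF landau_o.small.in_cong[OF ev] small])
  then have "(b k - c * a k) / fact k = 0" by (rule expansion_coeffs_zero[OF X _ k])
  then show ?thesis by simp
qed

section \<open>Comparison of coefficients at interior and boundary points\<close>

theorem theorem3:
  fixes F G :: "real \<Rightarrow> complex \<Rightarrow> complex"
    and f g :: "complex \<Rightarrow> complex"
    and \<tau> :: complex
  assumes "holo_semigroup F" and "holo_semigroup G"
    and "is_generator f F" and "is_generator g G"
    and "semigroups_commute F G"
  shows
    "(\<tau> \<in> unit_disk \<and> f \<tau> = 0 \<and> (\<exists>z\<in>unit_disk. f z \<noteq> 0) \<and> deriv f \<tau> = deriv g \<tau>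
        \<longrightarrow> (\<forall>z\<in>unit_disk. f z = g z)) \<and>
     (\<forall>m \<gamma> a b.
        \<tau> \<in> sphere 0 1 \<and> m \<ge> 1 \<and> curve_in_disk_to \<gamma> \<tau> \<and>
        expansion_along f \<tau> \<gamma> m a \<and> a 0 = 0 \<and>
        expansion_along g \<tau> \<gamma> m b \<and>
        a m = b m \<and> a m \<noteq> 0
        \<longrightarrow> (\<forall>z\<in>unit_disk. f z = g z))"
proof -
  have holf: "f holomorphic_on unit_disk" and holg: "g holomorphic_on unit_disk"
    by (rule generator_holomorphic[OF assms(1,3)], rule generator_holomorphic[OF assms(2,4)])
  have multiple: "\<exists>c. \<forall>z\<in>unit_disk. g z = c * f z" if "z0 \<in> unit_disk" "f z0 \<noteq> 0" for z0
    using proportional_if_bracket_zero[OF holf holg open_ball connected_ball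
        commute_generators_bracket[OF assms] that] by metis
  have interior: "\<forall>z\<in>unit_disk. f z = g z"
    if \<tau>: "\<tau> \<in> unit_disk" and "f \<tau> = 0" and z0: "z0 \<in> unit_disk" "f z0 \<noteq> 0"
      and eq: "deriv f \<tau> = deriv g \<tau>" for z0
  proof -
    obtain c where c: "\<And>z. z \<in> unit_disk \<Longrightarrow> g z = c * f z" using multiple[OF z0] by blast
    have f': "(f has_field_derivative deriv f \<tau>) (at \<tau>)"
      using holf \<tau> by (intro holomorphic_derivI) auto
    have "(g has_field_derivative c * deriv f \<tau>) (at \<tau>)"
      by (rule has_field_derivative_transform_within_open[OF DERIV_cmult[OF f'] open_ball \<tau>])
        (simp add: c)
    then have "deriv f \<tau> = c * deriv f \<tau>" by (rule trans[OF eq DERIV_imp_deriv])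
    \<comment> \<open>A double zero would make \<open>f\<close> vanish on the whole disk, contrary
      to \<open>z0\<close>; cancelling then gives \<open>c = 1\<close>.\<close>
    moreover have "deriv f \<tau> \<noteq> 0"
      using generator_double_zero[OF assms(1,3) \<tau> \<open>f \<tau> = 0\<close>] z0 by blast
    ultimately show ?thesis using c by simp
  qed
  have boundary: "\<forall>z\<in>unit_disk. f z = g z"
    if \<tau>: "\<tau> \<in> sphere 0 1" and \<gamma>: "curve_in_disk_to \<gamma> \<tau>"
      and ef: "expansion_along f \<tau> \<gamma> m a" and eg: "expansion_along g \<tau> \<gamma> m b"
      and eq: "a m = b m" "a m \<noteq> 0" for m \<gamma> a b
  proof -
    have \<tau>1: "cmod \<tau> = 1" using \<tau> by simp
    have "\<exists>z\<in>unit_disk. f z \<noteq> 0"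
    proof (rule ccontr)
      assume "\<not> ?thesis"
      \<comment> \<open>If \<open>f\<close> vanishes on the disk then \<open>f = 0 * f\<close>
        there, so its expansion is compared with itself for the factor 0.\<close>
      then have "a m = 0 * a m"
        by (intro expansion_along_scale_unique[OF \<tau>1 \<gamma> ef ef]) auto
      then show False using eq by simp
    qed
    then obtain c where c: "\<And>z. z \<in> unit_disk \<Longrightarrow> g z = c * f z" using multiple by blast
    have "b m = c * a m"
      by (rule expansion_along_scale_unique[OF \<tau>1 \<gamma> ef eg c]) auto
    then show ?thesis using eq c by simp
  qed
  show ?thesis
    by (intro conjI allI impI; elim conjE bexE)
      ((rule interior; assumption), (rule boundary; assumption))
qed

end
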